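(* Let $X$ be a finite set, $\alpha:X\to X$ a bijection and $r:X\to X$ a map with $r^2=\mathrm{id}$ and $\alpha^{-1}=r\alpha r$, and let $E\subseteq X$ be $r$-invariant ($r(E)=E$) such that $(X,\alpha)$ is $E$-bound. Consider the system $(X,[0,L],e,\alpha,r)$. (a) Let $i_{k+1}\to i_k\to\cdots\to i_1\to i_0$ be an $\alpha$-path (i.e. $\alpha(i_{u+1})=i_u$) with $i_0,i_{k+1}\in E$ and $i_u\in X\setminus E$ for $u\in[1,k]$. Then $ri_0\to ri_1\to\cdots\to ri_k\to ri_{k+1}$ is also an $\alpha$-path (i.e. $\alpha(ri_u)=ri_{u+1}$), with $ri_0,ri_{k+1}\in E$ and $ri_u\in X\setminus E$ for $u\in[1,k]$. (b) For such a path and $u\in[1,k]$: $S(ri_u)=S(i_u)$ if and only if $|X_u|=|X_{k-u+1}|$. (c) If $e(\alpha(E))=[0,L]$, then for such a path and $u\in[1,k]$: $S(ri_u)=S(i_u)$ if and only if $u=\frac{k+1}{2}$.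
   Context: $(X,\alpha)$ is $E$-bound if every $\alpha$-cycle meets $E$. The $E$-reaching time is $e(i)=$ the smallest $k\ge0$ with $\alpha^k(i)\in E$, and $L=\max_{i\in X}e(i)$. $X_k=e^{-1}(k)$ for $k\in[0,L]$. The system $(X,[0,L],e,\alpha,r)$ has macrostates $[0,L]$, micro-to-macro map $e$, and entropy $S(i)=\ln|X_{e(i)}|$. *)

theory Defs
  imports Complex_Main "HOL-Combinatorics.Orbits"
begin

(* orbit \<alpha> x consists of the points \<alpha>^n x with n \<ge> 1; the condition
   x \<in> orbit \<alpha> x says that x is periodic, so that its orbit is a cycle. *)
definition map_cycles :: "'a set \<Rightarrow> ('a \<Rightarrow> 'a) \<Rightarrow> 'a set set" where
  "map_cycles X \<alpha> = {orbit \<alpha> x | x. x \<in> X \<and> x \<in> orbit \<alpha> x}"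

definition bound_by :: "'a set \<Rightarrow> ('a \<Rightarrow> 'a) \<Rightarrow> 'a set \<Rightarrow> bool" where
  "bound_by X \<alpha> E \<longleftrightarrow> (\<forall>C \<in> map_cycles X \<alpha>. C \<inter> E \<noteq> {})"

(* Meaningful only for points that do reach E, hence on all of X if (X, \<alpha>) is E-bound and X is finite. *)
definition reaching_time :: "('a \<Rightarrow> 'a) \<Rightarrow> 'a set \<Rightarrow> 'a \<Rightarrow> nat" where
  "reaching_time \<alpha> E i = (LEAST k. (\<alpha> ^^ k) i \<in> E)"

definition max_reaching_time :: "'a set \<Rightarrow> ('a \<Rightarrow> 'a) \<Rightarrow> 'a set \<Rightarrow> nat" where
  "max_reaching_time X \<alpha> E = Max (reaching_time \<alpha> E ` X)"

definition level :: "'a set \<Rightarrow> ('a \<Rightarrow> 'a) \<Rightarrow> 'a set \<Rightarrow> nat \<Rightarrow> 'a set" where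
  "level X \<alpha> E k = {i \<in> X. reaching_time \<alpha> E i = k}"

definition entropy :: "'a set \<Rightarrow> ('a \<Rightarrow> 'a) \<Rightarrow> 'a set \<Rightarrow> 'a \<Rightarrow> real" where
  "entropy X \<alpha> E i = ln (real (card (level X \<alpha> E (reaching_time \<alpha> E i))))"

(* The path i(k+1) \<rightarrow> i(k) \<rightarrow> ... \<rightarrow> i(1) \<rightarrow> i(0), which is outside E exactly at its inner points;
   the values of i beyond k+1 are irrelevant. *)
definition excursion :: "'a set \<Rightarrow> ('a \<Rightarrow> 'a) \<Rightarrow> 'a set \<Rightarrow> nat \<Rightarrow> (nat \<Rightarrow> 'a) \<Rightarrow> bool" where
  "excursion X \<alpha> E k i \<longleftrightarrow>
     (\<forall>u \<in> {0..k}. \<alpha> (i (u + 1)) = i u) \<and>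
     i 0 \<in> E \<and> i (k + 1) \<in> E \<and> (\<forall>u \<in> {1..k}. i u \<in> X - E)"

end

theory Submission
  imports Defs
begin

text \<open>
  The reversal \<open>r\<close> maps the excursion \<open>i\<^sub>0, \<dots>, i\<^sub>k\<^sub>+\<^sub>1\<close> to the excursion traversed backwards, so
  \<open>e(i\<^sub>u) = u\<close> while \<open>e(r i\<^sub>u) = k + 1 - u\<close>. The map \<open>\<alpha>\<close> injects \<open>X\<^sub>k\<^sub>+\<^sub>1\<close> into \<open>X\<^sub>k\<close>, and its
  image misses the points of \<open>X\<^sub>k \<inter> \<alpha>(E)\<close>. If \<open>e(\<alpha>(E)) = [0,L]\<close>, then these sets are all
  nonempty, so \<open>|X\<^sub>k|\<close> is strictly decreasing in \<open>k\<close> and equal sizes force equal levels.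
\<close>

text \<open>Pigeonhole: the iterates of \<open>x\<close> stay in a finite set, so two of them agree,
  and injectivity strips off the common initial iterations until the repeated value is
  \<open>x\<close> itself.\<close>

lemma inj_on_finite_funpow_periodic:
  assumes "finite X" and "inj_on f X" and "f ` X \<subseteq> X" and "x \<in> X"
  shows "\<exists>n>0. (f ^^ n) x = x"
proof -
  have in_X: "(f ^^ n) x \<in> X" for n
    using assms by (induction n) auto
  have cancel: "(f ^^ m) x = (f ^^ (m + d)) x \<Longrightarrow> (f ^^ d) x = x" for m d
  proof (induction m)
    case (Suc m)
    then have "f ((f ^^ m) x) = f ((f ^^ (m + d)) x)" by simp
    then have "(f ^^ m) x = (f ^^ (m + d)) x"
      using inj_onD[OF assms(2)] in_X by blast
    then show ?case by (rule Suc.IH)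
  qed simp
  have "range (\<lambda>n. (f ^^ n) x) \<subseteq> X" using in_X by auto
  then have "finite (range (\<lambda>n. (f ^^ n) x))" using assms(1) finite_subset by blast
  then have "\<not> inj (\<lambda>n. (f ^^ n) x)"
    using finite_imageD infinite_UNIV_nat by blast
  then obtain m n where "m < n" "(f ^^ m) x = (f ^^ n) x"
    unfolding inj_def by (metis linorder_neqE_nat)
  then have "(f ^^ (n - m)) x = x" using cancel[of m "n - m"] by simp
  then show ?thesis using \<open>m < n\<close> by (intro exI[of _ "n - m"]) simp
qed

text \<open>Every point of \<open>X\<close> is periodic, so its orbit is one of the cycles that
  \<open>bound_by\<close> requires to meet \<open>E\<close>. This makes the \<open>LEAST\<close> in
  \<open>reaching_time\<close> a genuine minimum on \<open>X\<close>.\<close>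

lemma bound_by_reaches:
  assumes "finite X" and "bij_betw \<alpha> X X" and "bound_by X \<alpha> E" and "x \<in> X"
  shows "\<exists>k. (\<alpha> ^^ k) x \<in> E"
proof -
  obtain n where "n > 0" "(\<alpha> ^^ n) x = x"
    using inj_on_finite_funpow_periodic[of X \<alpha> x] assms by (auto simp: bij_betw_def)
  \<comment> \<open>The orbit consists of iterates with positive exponent, hence the need for
    \<open>n > 0\<close>.\<close>
  then have "x \<in> orbit \<alpha> x" unfolding orbit_altdef by force
  then have "orbit \<alpha> x \<inter> E \<noteq> {}"
    using assms(3,4) unfolding bound_by_def map_cycles_def by blast
  then show ?thesis unfolding orbit_altdef by blast
qed

text \<open>The exponent \<open>n\<close> witnesses that \<open>E\<close> is reached at all, and
  \<open>x \<notin> E\<close> rules out exponent 0, so the least exponent can be shifted by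
  one.\<close>

lemma reaching_time_step:
  assumes "(\<alpha> ^^ n) x \<in> E" and "x \<notin> E"
  shows "reaching_time \<alpha> E x = Suc (reaching_time \<alpha> E (\<alpha> x))"
  using Least_Suc[of "\<lambda>k. (\<alpha> ^^ k) x \<in> E" n] assms
  unfolding reaching_time_def by (simp add: funpow_swap1)

lemma excursion_funpow:
  assumes "excursion X \<alpha> E k i" and "u \<le> k + 1" and "v \<le> u"
  shows "(\<alpha> ^^ v) (i u) = i (u - v)"
  using assms(3)
proof (induction v)
  case (Suc v)
  have "\<alpha> (i (u - Suc v + 1)) = i (u - Suc v)"
    using assms(1,2) unfolding excursion_def by auto
  then show ?case using Suc by (simp add: Suc_diff_Suc)
qed simp

lemma excursion_reaching_time:
  assumes "excursion X \<alpha> E k i" and "u \<in> {1..k}"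
  shows "reaching_time \<alpha> E (i u) = u"
  unfolding reaching_time_def
proof (rule Least_equality)
  show "(\<alpha> ^^ u) (i u) \<in> E"
    using excursion_funpow[OF assms(1), of u u] assms by (simp add: excursion_def)
next
  fix v assume v: "(\<alpha> ^^ v) (i u) \<in> E"
  show "u \<le> v"
  proof (rule ccontr)
    assume "\<not> u \<le> v"
    then have "(\<alpha> ^^ v) (i u) = i (u - v)" "u - v \<in> {1..k}"
      using excursion_funpow[OF assms(1), of u v] assms(2) by auto
    then show False using v assms(1) by (auto simp: excursion_def)
  qed
qed

text \<open>Conjugation by \<open>r\<close> turns \<alpha> into its inverse and so reverses arrows.
  The indexing by \<open>k + 1 - u\<close> restores the descending order of an excursion, so that
  results on excursions apply to the reversed path as well.\<close>

lemma excursion_reverse: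
  assumes "bij_betw \<alpha> X X" and "r \<in> X \<rightarrow> X" and "\<forall>x \<in> X. r (r x) = x"
    and "\<forall>x \<in> X. inv_into X \<alpha> x = r (\<alpha> (r x))"
    and "E \<subseteq> X" and "r ` E = E" and "excursion X \<alpha> E k i"
  shows "excursion X \<alpha> E k (\<lambda>u. r (i (k + 1 - u)))"
proof -
  have in_X: "i u \<in> X" if u: "u \<le> k + 1" for u
  proof -
    consider "u = 0" | "u = k + 1" | "u \<in> {1..k}" using u by fastforce
    then show ?thesis using assms(5,7) by cases (auto simp: excursion_def)
  qed
  have step: "\<alpha> (r (i u)) = r (i (u + 1))" if "u \<le> k" for u
  proof -
    have "\<alpha> (i (u + 1)) = i u" using assms(7) that by (auto simp: excursion_def)
    then have "i (u + 1) = inv_into X \<alpha> (i u)"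
      using inv_into_f_f[of \<alpha> X "i (u + 1)"] in_X[of "u + 1"] assms(1) that
      by (simp add: bij_betw_def)
    also have "\<dots> = r (\<alpha> (r (i u)))" using assms(4) in_X that by simp
    finally have "r (i (u + 1)) = r (r (\<alpha> (r (i u))))" by simp
    moreover have "\<alpha> (r (i u)) \<in> X"
      using assms(1,2) in_X[of u] that by (auto simp: bij_betw_def)
    ultimately show ?thesis using assms(3) by simp
  qed
  have outside: "r x \<in> X - E" if "x \<in> X - E" for x
    using that assms(2,3,6) by (metis Diff_iff PiE imageI)
  show ?thesis unfolding excursion_def
  proof (intro conjI ballI)
    fix u assume "u \<in> {0..k}"
    then show "\<alpha> (r (i (k + 1 - (u + 1)))) = r (i (k + 1 - u))"
      using step[of "k - u"] by (simp add: Suc_diff_le)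
  next
    show "r (i (k + 1 - 0)) \<in> E" "r (i (k + 1 - (k + 1))) \<in> E"
      using assms(6,7) by (auto simp: excursion_def)
  next
    fix u assume "u \<in> {1..k}"
    then have "k + 1 - u \<in> {1..k}" by auto
    then show "r (i (k + 1 - u)) \<in> X - E"
      using assms(7) outside by (auto simp: excursion_def)
  qed
qed

lemma card_level_Suc_less:
  assumes "finite X" and "bij_betw \<alpha> X X" and "E \<subseteq> X" and "bound_by X \<alpha> E"
    and "k \<in> reaching_time \<alpha> E ` (\<alpha> ` E)"
  shows "card (level X \<alpha> E (Suc k)) < card (level X \<alpha> E k)"
proof -
  have inj: "inj_on \<alpha> X" and img: "\<alpha> ` X = X" using assms(2) by (auto simp: bij_betw_def)
  have not_E: "x \<notin> E" if "reaching_time \<alpha> E x = Suc n" for x n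
  proof
    assume "x \<in> E"
    then have "reaching_time \<alpha> E x = 0" by (simp add: reaching_time_def)
    then show False using that by simp
  qed
  have "\<alpha> x \<in> level X \<alpha> E k" if x: "x \<in> level X \<alpha> E (Suc k)" for x
  proof -
    obtain n where "(\<alpha> ^^ n) x \<in> E"
      using bound_by_reaches[OF assms(1,2,4)] x by (auto simp: level_def)
    then show ?thesis
      using reaching_time_step[of n \<alpha> x E] not_E x img by (auto simp: level_def)
  qed
  moreover obtain y where y: "y \<in> E" "reaching_time \<alpha> E (\<alpha> y) = k" using assms(5) by auto
  moreover have "\<alpha> y \<in> level X \<alpha> E k" using y assms(3) img by (auto simp: level_def)
  \<comment> \<open>By injectivity the only preimage of \<open>\<alpha> y\<close> in
    \<open>X\<close> is \<open>y\<close>, which lies in \<open>E\<close> and so has reaching time 0,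
    not \<open>Suc k\<close>.\<close>
  moreover have "\<alpha> y \<notin> \<alpha> ` level X \<alpha> E (Suc k)"
    using inj_onD[OF inj] y(1) assms(3) not_E by (fastforce simp: level_def)
  ultimately have "\<alpha> ` level X \<alpha> E (Suc k) \<subset> level X \<alpha> E k" by blast
  then have "card (\<alpha> ` level X \<alpha> E (Suc k)) < card (level X \<alpha> E k)"
    using assms(1) by (intro psubset_card_mono) (simp add: level_def)
  moreover have "inj_on \<alpha> (level X \<alpha> E (Suc k))"
    using inj by (rule inj_on_subset) (auto simp: level_def)
  ultimately show ?thesis by (simp add: card_image)
qed

lemma card_level_inj_on:
  assumes "finite X" and "bij_betw \<alpha> X X" and "E \<subseteq> X" and "bound_by X \<alpha> E"
    and "reaching_time \<alpha> E ` (\<alpha> ` E) = {0..L}"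
  shows "inj_on (\<lambda>k. card (level X \<alpha> E k)) {0..L}"
proof -
  have less: "card (level X \<alpha> E n) < card (level X \<alpha> E m)" if "m < n" "n \<le> L" for m n
    using that
  proof (induction n rule: less_induct)
    case (less n)
    then obtain n' where n: "n = Suc n'" by (cases n) auto
    have "card (level X \<alpha> E n) < card (level X \<alpha> E n')"
      unfolding n using card_level_Suc_less[OF assms(1-4)] assms(5) less.prems n by simp
    then show ?case using less.IH[of n'] less.prems n by (cases "m = n'") auto
  qed
  show ?thesis
    by (rule linorder_inj_onI') (use less in fastforce)
qed

text \<open>The logarithm is injective on positive arguments, and the level of a point of
  \<open>X\<close> is nonempty because it contains that point.\<close>

lemma entropy_eq_iff:
  assumes "finite X" and "x \<in> X" and "y \<in> X"
  shows "entropy X \<alpha> E x = entropy X \<alpha> E y \<longleftrightarrow>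
    card (level X \<alpha> E (reaching_time \<alpha> E x)) = card (level X \<alpha> E (reaching_time \<alpha> E y))"
proof -
  have "card (level X \<alpha> E (reaching_time \<alpha> E z)) > 0" if "z \<in> X" for z
    using assms(1) that by (auto simp: card_gt_0_iff level_def)
  then show ?thesis using assms by (simp add: entropy_def)
qed

theorem theorem30:
  fixes X E :: "'a set" and \<alpha> r :: "'a \<Rightarrow> 'a"
  assumes "finite X"
    and "bij_betw \<alpha> X X"
    and "r \<in> X \<rightarrow> X"
    and "\<forall>x \<in> X. r (r x) = x"
    and "\<forall>x \<in> X. inv_into X \<alpha> x = r (\<alpha> (r x))"
    and "E \<subseteq> X"
    and "r ` E = E"
    and "bound_by X \<alpha> E"
  shows "(\<forall>k i. excursion X \<alpha> E k i \<longrightarrow>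
            (\<forall>u \<in> {0..k}. \<alpha> (r (i u)) = r (i (u + 1))) \<and>
            r (i 0) \<in> E \<and> r (i (k + 1)) \<in> E \<and>
            (\<forall>u \<in> {1..k}. r (i u) \<in> X - E))
       \<and> (\<forall>k i. excursion X \<alpha> E k i \<longrightarrow>
            (\<forall>u \<in> {1..k}. entropy X \<alpha> E (r (i u)) = entropy X \<alpha> E (i u) \<longleftrightarrow>
               card (level X \<alpha> E u) = card (level X \<alpha> E (k - u + 1))))
       \<and> (reaching_time \<alpha> E ` (\<alpha> ` E) = {0..max_reaching_time X \<alpha> E} \<longrightarrow>
            (\<forall>k i. excursion X \<alpha> E k i \<longrightarrow>
               (\<forall>u \<in> {1..k}. entropy X \<alpha> E (r (i u)) = entropy X \<alpha> E (i u) \<longleftrightarrow>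
                  real u = (real k + 1) / 2)))"
proof -
  note rev = excursion_reverse[OF assms(2-7)]
  have path: "\<alpha> (r (i u)) = r (i (u + 1))" if "excursion X \<alpha> E k i" "u \<in> {0..k}" for k i u
  proof -
    have "\<forall>v \<in> {0..k}. \<alpha> (r (i (k + 1 - (v + 1)))) = r (i (k + 1 - v))"
      using rev[OF that(1)] by (simp add: excursion_def)
    \<comment> \<open>The substitution \<open>v = k - u\<close> undoes the reversed
      indexing.\<close>
    from bspec[OF this, of "k - u"] show ?thesis using that(2) by (simp add: Suc_diff_le)
  qed
  have ends: "r (i 0) \<in> E" "r (i (k + 1)) \<in> E" if "excursion X \<alpha> E k i" for k i
    using rev[OF that] by (simp_all add: excursion_def)
  have inner: "r (i u) \<in> X - E" if "excursion X \<alpha> E k i" "u \<in> {1..k}" for k i u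
  proof -
    have "\<forall>v \<in> {1..k}. r (i (k + 1 - v)) \<in> X - E"
      using rev[OF that(1)] by (simp add: excursion_def)
    moreover have "k + 1 - u \<in> {1..k}" "k + 1 - (k + 1 - u) = u" using that(2) by auto
    ultimately show ?thesis by metis
  qed
  have inner': "i u \<in> X" if "excursion X \<alpha> E k i" "u \<in> {1..k}" for k i u
    using that by (auto simp: excursion_def)
  have time: "reaching_time \<alpha> E (r (i u)) = k - u + 1"
    if "excursion X \<alpha> E k i" "u \<in> {1..k}" for k i u
    \<comment> \<open>The point \<open>r (i u)\<close> stands at position \<open>k + 1 - u\<close>
      of the reversed excursion.\<close>
    using excursion_reaching_time[OF rev[OF that(1)], of "k + 1 - u"] that(2)
    by (auto simp: Suc_diff_le)
  have entropy_iff: "entropy X \<alpha> E (r (i u)) = entropy X \<alpha> E (i u) \<longleftrightarrow>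
      card (level X \<alpha> E u) = card (level X \<alpha> E (k - u + 1))"
    if "excursion X \<alpha> E k i" "u \<in> {1..k}" for k i u
    using entropy_eq_iff[OF assms(1), of "r (i u)" "i u" \<alpha> E] inner[OF that] inner'[OF that]
      time[OF that] excursion_reaching_time[OF that] by auto
  have "entropy X \<alpha> E (r (i u)) = entropy X \<alpha> E (i u) \<longleftrightarrow> real u = (real k + 1) / 2"
    if surj: "reaching_time \<alpha> E ` (\<alpha> ` E) = {0..max_reaching_time X \<alpha> E}"
      and exc: "excursion X \<alpha> E k i" and u: "u \<in> {1..k}" for k i u
  proof -
    have le: "reaching_time \<alpha> E x \<le> max_reaching_time X \<alpha> E" if "x \<in> X" for x
      using assms(1) that by (simp add: max_reaching_time_def)
    \<comment> \<open>Both indices are reaching times of points of \<open>X\<close>, namely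
      \<open>i u\<close> and \<open>r (i u)\<close>, so they lie in the range where the level sizes
      are pairwise distinct.\<close>
    have "u \<le> max_reaching_time X \<alpha> E" "k - u + 1 \<le> max_reaching_time X \<alpha> E"
      using le[OF inner'[OF exc u]] le[of "r (i u)"] inner[OF exc u]
        time[OF exc u] excursion_reaching_time[OF exc u] by auto
    then have "card (level X \<alpha> E u) = card (level X \<alpha> E (k - u + 1)) \<longleftrightarrow> u = k - u + 1"
      using inj_on_eq_iff[OF card_level_inj_on[OF assms(1,2,6,8) surj], of u "k - u + 1"]
      by simp
    \<comment> \<open>Here \<open>u \<le> k\<close> ensures that the subtraction on naturals is not
      truncated.\<close>
    also have "\<dots> \<longleftrightarrow> real u = (real k + 1) / 2" using u by auto
    finally show ?thesis using entropy_iff[OF exc u] by simp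
  qed
  then show ?thesis using path ends inner entropy_iff by blast
qed

end
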